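(* Let $\mathsf h_0(\xi,\eta)=\int_I\frac{\xi^2+\eta^2}{2}\,dy$ and $$\mathsf F_1(\xi,\eta)=\int_I\left(-\frac{[\partial_{y_1}(\xi-\eta)]^2}{48}+\frac{[\partial_{y_2}\partial_{y_1}^{-1}(\xi-\eta)]^2}{4}+\alpha\frac{(\xi+\eta)^3}{3\cdot2^{3/2}}\right)dy ,$$ and let $\langle\mathsf F_1\rangle$ be the average of $\mathsf F_1$ along the flow of $\mathsf h_0$. Then the equations of motion associated to the Hamiltonian $\mathsf h_0+\mu^2\langle\mathsf F_1\rangle$ are $$\begin{cases}\xi_\tau=-\partial_{y_1}\xi-\frac{\mu^2}{24}\partial_{y_1}^3\xi-\frac{\mu^2}{2}\partial_{y_1}^{-1}\partial_{y_2}^2\xi-\frac{\alpha\mu^2}{2\sqrt2}\,\partial_{y_1}(\xi^2)\\[2pt] \eta_\tau=\partial_{y_1}\eta+\frac{\mu^2}{2}\partial_{y_1}^{-1}\partial_{y_2}^2\eta+\frac{\mu^2}{24}\partial_{y_1}^3\eta+\frac{\alpha\mu^2}{2\sqrt2}\,\partial_{y_1}(\eta^2).\end{cases}$$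
   Context: $I=[-1,1]^2$; $\xi,\eta$ are (sufficiently regular) real functions on $I$, 2-periodic in $y_1$ and in $y_2$, with zero average in $y_1$ for every $y_2$; $\partial_{y_1}^{-1}$ is the inverse of $\partial_{y_1}$ on functions with zero $y_1$-average for every $y_2$. $\alpha\in\mathbb R\setminus\{0\}$ and $\mu>0$ are parameters. Hamilton's equations of a Hamiltonian $\mathsf K(\xi,\eta)$ are, with Poisson tensor $J=\partial_{y_1}\begin{pmatrix}-1&0\\0&1\end{pmatrix}$, $\partial_\tau\xi=-\partial_{y_1}\frac{\delta\mathsf K}{\delta\xi}$, $\partial_\tau\eta=\partial_{y_1}\frac{\delta\mathsf K}{\delta\eta}$. The flow of $\mathsf h_0$ is $\Phi^\tau(\xi,\eta)(y)=(\xi(y_1-\tau,y_2),\eta(y_1+\tau,y_2))$, of period $T=2$, and $\langle\mathsf F_1\rangle(\xi,\eta)=\frac1T\int_0^T\mathsf F_1(\Phi^\tau(\xi,\eta))\,d\tau$. *)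

theory Defs
  imports "HOL-Analysis.Analysis"
begin

type_synonym field = "real \<times> real \<Rightarrow> real"

definition Icell :: "(real \<times> real) set" where
  "Icell = {-1..1} \<times> {-1..1}"

definition D1 :: "field \<Rightarrow> field" where
  "D1 f = (\<lambda>(y1, y2). deriv (\<lambda>s. f (s, y2)) y1)"

definition D2 :: "field \<Rightarrow> field" where
  "D2 f = (\<lambda>(y1, y2). deriv (\<lambda>s. f (y1, s)) y2)"

primrec Ck :: "nat \<Rightarrow> field \<Rightarrow> bool" where
  "Ck 0 f \<longleftrightarrow> continuous_on UNIV f"
| "Ck (Suc n) f \<longleftrightarrow> continuous_on UNIV f \<and>
     (\<forall>y1 y2. (\<lambda>s. f (s, y2)) differentiable (at y1)) \<and>
     (\<forall>y1 y2. (\<lambda>s. f (y1, s)) differentiable (at y2)) \<and>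
     Ck n (D1 f) \<and> Ck n (D2 f)"

definition biperiodic :: "field \<Rightarrow> bool" where
  "biperiodic f \<longleftrightarrow>
     (\<forall>y1 y2. f (y1 + 2, y2) = f (y1, y2) \<and> f (y1, y2 + 2) = f (y1, y2))"

definition zero_avg1 :: "field \<Rightarrow> bool" where
  "zero_avg1 f \<longleftrightarrow> (\<forall>y2. ((\<lambda>y1. f (y1, y2)) has_integral 0) {-1..1})"

definition fields :: "nat \<Rightarrow> field set" where
  "fields n = {f. Ck n f \<and> biperiodic f \<and> zero_avg1 f}"

definition D1inv :: "field \<Rightarrow> field" where
  "D1inv f = (THE g. biperiodic g \<and> zero_avg1 g \<and>
     (\<forall>y1 y2. ((\<lambda>s. g (s, y2)) has_real_derivative f (y1, y2)) (at y1)))"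

(* The L2(I)-gradient. Variations and gradient both have zero y1-average, since D1inv only
   makes sense there; this fixes the gradient uniquely. Any other representative differs from
   it by a function of y2 alone, which the Poisson tensor annihilates. The functionals below
   need only one derivative of their arguments, hence the class C^1. *)
definition has_variational_derivative :: "(field \<Rightarrow> real) \<Rightarrow> field \<Rightarrow> field \<Rightarrow> bool" where
  "has_variational_derivative F u g \<longleftrightarrow> g \<in> fields 1 \<and>
     (\<forall>h \<in> fields 1.
        ((\<lambda>\<epsilon>. F (\<lambda>y. u y + \<epsilon> * h y)) has_real_derivative integral Icell (\<lambda>y. g y * h y)) (at 0))"

definition variational_derivative :: "(field \<Rightarrow> real) \<Rightarrow> field \<Rightarrow> field" where
  "variational_derivative F u = (THE g. has_variational_derivative F u g)"

(* Hamilton's equations on the time set S, for the Poisson tensor diag(-D1, D1). *)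
definition solves_hamilton ::
  "(field \<Rightarrow> field \<Rightarrow> real) \<Rightarrow> real set \<Rightarrow> (real \<Rightarrow> field) \<Rightarrow> (real \<Rightarrow> field) \<Rightarrow> bool" where
  "solves_hamilton K S \<xi> \<eta> \<longleftrightarrow> (\<forall>\<tau>\<in>S. \<forall>y.
     ((\<lambda>t. \<xi> t y) has_real_derivative
        - D1 (variational_derivative (\<lambda>u. K u (\<eta> \<tau>)) (\<xi> \<tau>)) y) (at \<tau>) \<and>
     ((\<lambda>t. \<eta> t y) has_real_derivative
        D1 (variational_derivative (\<lambda>v. K (\<xi> \<tau>) v) (\<eta> \<tau>)) y) (at \<tau>))"

definition h0 :: "field \<Rightarrow> field \<Rightarrow> real" where
  "h0 \<xi> \<eta> = integral Icell (\<lambda>y. ((\<xi> y)\<^sup>2 + (\<eta> y)\<^sup>2) / 2)"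

definition F1 :: "real \<Rightarrow> field \<Rightarrow> field \<Rightarrow> real" where
  "F1 \<alpha> \<xi> \<eta> = integral Icell (\<lambda>y.
     - (D1 (\<lambda>z. \<xi> z - \<eta> z) y)\<^sup>2 / 48
     + (D2 (D1inv (\<lambda>z. \<xi> z - \<eta> z)) y)\<^sup>2 / 4
     + \<alpha> * (\<xi> y + \<eta> y) ^ 3 / (3 * 2 powr (3/2)))"

definition h0_flow :: "real \<Rightarrow> field \<Rightarrow> field \<Rightarrow> field \<times> field" where
  "h0_flow \<tau> \<xi> \<eta> = (\<lambda>(y1, y2). \<xi> (y1 - \<tau>, y2), \<lambda>(y1, y2). \<eta> (y1 + \<tau>, y2))"

definition flow_average :: "(field \<Rightarrow> field \<Rightarrow> real) \<Rightarrow> field \<Rightarrow> field \<Rightarrow> real" where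
  "flow_average F \<xi> \<eta> = 1 / 2 * integral {0..2} (\<lambda>\<tau>. case_prod F (h0_flow \<tau> \<xi> \<eta>))"

definition averaged_hamiltonian :: "real \<Rightarrow> real \<Rightarrow> field \<Rightarrow> field \<Rightarrow> real" where
  "averaged_hamiltonian \<alpha> \<mu> \<xi> \<eta> = h0 \<xi> \<eta> + \<mu>\<^sup>2 * flow_average (F1 \<alpha>) \<xi> \<eta>"

end

theory Submission
  imports Defs
begin

text \<open>
  On zero-average periodic fields the inverse of \<open>D1\<close> is the integral operator \<open>prim1\<close> with kernel
  \<open>t / 2\<close> on the period, so it commutes with \<open>D2\<close> and with translations. In \<open>F1\<close> along the flow,
  every product of a factor translated by \<open>-\<tau>\<close> and one translated by \<open>\<tau>\<close> integrates to zero over a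
  period as soon as one of the two factors has zero average. Hence the averaged Hamiltonian splits as
  \<open>E \<xi> + E \<eta>\<close> with one functional \<open>E\<close> (\<open>energy\<close>). Its value at \<open>u + \<epsilon> h\<close> is a cubic polynomial
  in \<open>\<epsilon>\<close>, and the linear coefficient is brought to gradient form by integrating by parts, writing
  \<open>h = D1 (prim1 h)\<close> in the nonlocal and cubic terms. Zero-average gradients are unique because
  their difference may be used as a variation.
\<close>

subsection \<open>Calculus of periodic fields\<close>

lemma continuous_on_field:
  fixes f :: field
  assumes "continuous_on UNIV f" "continuous_on S g" "continuous_on S h"
  shows "continuous_on S (\<lambda>x. f (g x, h x))"
  using assms by (auto intro!: continuous_on_compose2[of UNIV f S "\<lambda>x. (g x, h x)"] continuous_intros)

lemma antiderivative_UNIV: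
  fixes p :: "real \<Rightarrow> real"
  assumes "continuous_on UNIV p"
  obtains F where "\<And>x. (F has_real_derivative p x) (at x)"
proof -
  have "\<exists>F. \<forall>x. - \<infinity> < ereal x \<longrightarrow> ereal x < \<infinity> \<longrightarrow> (F has_vector_derivative p x) (at x)"
    using assms by (intro einterval_antiderivative) (auto simp: continuous_on_eq_continuous_at)
  then obtain F where "\<And>x. (F has_vector_derivative p x) (at x)" by auto
  then show ?thesis
    using that[of F] unfolding has_real_derivative_iff_has_vector_derivative by blast
qed

text \<open>For an antiderivative F of p, the function F (x + 2) - F x has derivative p (x + 2) - p
  x = 0. It is therefore constant, and it is the integral of p over every window of length
  2.\<close>

lemma has_integral_periodic_shift:
  fixes p :: "real \<Rightarrow> real"
  assumes c: "continuous_on UNIV p" and per: "\<And>x. p (x + 2) = p x" and b: "b = a + 2"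
  shows "((\<lambda>x. p (x + s)) has_integral integral {-1..1} p) {a..b}"
proof -
  obtain F where F: "\<And>x. (F has_real_derivative p x) (at x)"
    using antiderivative_UNIV[OF c] by metis
  have FTC: "((\<lambda>x. p (x + s)) has_integral F (b + s) - F (a + s)) {a..b}" if "a \<le> b" for a b s
  proof (rule fundamental_theorem_of_calculus[OF that])
    fix x
    show "((\<lambda>x. F (x + s)) has_vector_derivative p (x + s)) (at x within {a..b})"
      unfolding has_real_derivative_iff_has_vector_derivative[symmetric]
      by (rule has_field_derivative_at_within) (use F[of "x + s"] in \<open>simp add: DERIV_shift\<close>)
  qed
  have "((\<lambda>x. F (x + 2) - F x) has_real_derivative 0) (at x)" for x
    using DERIV_diff[OF F[of "x + 2", unfolded DERIV_shift] F] per by simp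
  then have "F (x + 2) - F x = F 1 - F (-1)" for x
    using DERIV_isconst_all[of "\<lambda>x. F (x + 2) - F x" x "-1"] by simp
  from this[of "a + s"] have "F (b + s) - F (a + s) = F 1 - F (-1)"
    by (simp add: b add_ac)
  moreover have "integral {-1..1} p = F 1 - F (-1)"
    using FTC[of "-1" 1 0] by (auto dest: integral_unique)
  ultimately show ?thesis using FTC[of a b s] b by simp
qed

text \<open>Both orders are used: the inner y1-integral for zero averages, \<open>D1\<close> and
  translations, the inner y2-integral for the boundary terms of \<open>D2\<close>.\<close>

lemma integral_Icell:
  fixes f :: field
  assumes "continuous_on UNIV f"
  shows "integral Icell f = integral {-1..1} (\<lambda>y2. integral {-1..1} (\<lambda>y1. f (y1, y2)))"
    and "integral Icell f = integral {-1..1} (\<lambda>y1. integral {-1..1} (\<lambda>y2. f (y1, y2)))"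
proof -
  have c: "continuous_on (cbox (-1,-1) (1,1)) f"
    by (rule continuous_on_subset[OF assms subset_UNIV])
  have e: "Icell = cbox (-1,-1) (1,1)"
    by (simp add: Icell_def cbox_Pair_eq)
  show 1: "integral Icell f = integral {-1..1} (\<lambda>y1. integral {-1..1} (\<lambda>y2. f (y1, y2)))"
    using integral_prod_continuous[OF c] by (simp add: e)
  show "integral Icell f = integral {-1..1} (\<lambda>y2. integral {-1..1} (\<lambda>y1. f (y1, y2)))"
    using integral_swap_continuous[of "-1" "-1" 1 1 "\<lambda>x y. f (x, y)"] c 1 by simp
qed

lemma integrable_Icell:
  fixes f :: field
  assumes "continuous_on UNIV f"
  shows "f integrable_on Icell"
proof -
  have "Icell = cbox (-1,-1) (1,1)"
    by (simp add: Icell_def cbox_Pair_eq)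
  then show ?thesis
    using integrable_continuous[OF continuous_on_subset[OF assms subset_UNIV], of "(-1,-1)" "(1,1)"] by simp
qed

section \<open>Partial derivatives and the classes \<open>Ck\<close>\<close>

lemma D1_eqI: "(\<And>y1 y2. ((\<lambda>s. f (s, y2)) has_real_derivative g (y1, y2)) (at y1)) \<Longrightarrow> D1 f = g"
  by (simp add: D1_def fun_eq_iff DERIV_imp_deriv)

lemma D2_eqI: "(\<And>y1 y2. ((\<lambda>s. f (y1, s)) has_real_derivative g (y1, y2)) (at y2)) \<Longrightarrow> D2 f = g"
  by (simp add: D2_def fun_eq_iff DERIV_imp_deriv)

lemma Ck_continuous: "Ck n f \<Longrightarrow> continuous_on UNIV f"
  by (cases n) simp_all

lemma Ck_SucD: "Ck (Suc n) f \<Longrightarrow> Ck n f"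
proof (induction n arbitrary: f)
  case (Suc n)
  from Suc.prems[unfolded Ck.simps(2)[of "Suc n" f]] show ?case
    unfolding Ck.simps(2)[of n f] using Suc.IH by blast
qed simp

lemma Ck_mono: "Ck n f \<Longrightarrow> m \<le> n \<Longrightarrow> Ck m f"
proof (induction n)
  case (Suc n)
  then show ?case using Ck_SucD by (cases "m = Suc n") (auto simp del: Ck.simps)
qed simp

lemma DERIV_D1:
  assumes "Ck (Suc n) f"
  shows "((\<lambda>s. f (s, y2)) has_real_derivative D1 f (y1, y2)) (at y1)"
  using assms by (simp add: D1_def DERIV_deriv_iff_real_differentiable)

lemma DERIV_D2:
  assumes "Ck (Suc n) f"
  shows "((\<lambda>s. f (y1, s)) has_real_derivative D2 f (y1, y2)) (at y2)"
  using assms by (simp add: D2_def DERIV_deriv_iff_real_differentiable)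

text \<open>With the partial derivatives supplied as explicit functions, a closure proof by
  induction on the order only has to exhibit them and apply the induction hypothesis to
  them.\<close>

lemma Ck_SucI:
  assumes "continuous_on UNIV f"
    and "\<And>y1 y2. ((\<lambda>s. f (s, y2)) has_real_derivative f1 (y1, y2)) (at y1)"
    and "\<And>y1 y2. ((\<lambda>s. f (y1, s)) has_real_derivative f2 (y1, y2)) (at y2)"
    and "Ck n f1" "Ck n f2"
  shows "Ck (Suc n) f"
proof -
  have "D1 f = f1" "D2 f = f2"
    using assms by (blast intro: D1_eqI D2_eqI)+
  then show ?thesis
    unfolding Ck.simps real_differentiable_def using assms by blast
qed

lemma DERIV_D_lincomb:
  assumes "Ck (Suc n) f" "Ck (Suc n) g"
  shows "((\<lambda>s. a * f (s, y2) + b * g (s, y2)) has_real_derivative a * D1 f (y1, y2) + b * D1 g (y1, y2)) (at y1)"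
    and "((\<lambda>s. a * f (y1, s) + b * g (y1, s)) has_real_derivative a * D2 f (y1, y2) + b * D2 g (y1, y2)) (at y2)"
  by (intro DERIV_add DERIV_cmult DERIV_D1[OF assms(1)] DERIV_D1[OF assms(2)]
      DERIV_D2[OF assms(1)] DERIV_D2[OF assms(2)])+

lemma D_lincomb:
  assumes "Ck (Suc n) f" "Ck (Suc n) g"
  shows "D1 (\<lambda>y. a * f y + b * g y) = (\<lambda>y. a * D1 f y + b * D1 g y)"
    and "D2 (\<lambda>y. a * f y + b * g y) = (\<lambda>y. a * D2 f y + b * D2 g y)"
  by (rule D1_eqI D2_eqI, rule DERIV_D_lincomb[OF assms])+

lemma Ck_lincomb: "Ck n f \<Longrightarrow> Ck n g \<Longrightarrow> Ck n (\<lambda>y. a * f y + b * g y)"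
proof (induction n arbitrary: f g)
  case 0
  then show ?case by (auto intro!: continuous_intros)
next
  case (Suc n)
  show ?case
  proof (rule Ck_SucI[OF _ DERIV_D_lincomb[OF Suc.prems]])
    show "continuous_on UNIV (\<lambda>y. a * f y + b * g y)"
      using Suc.prems[THEN Ck_continuous] by (intro continuous_intros)
  qed (use Suc in auto)
qed

text \<open>The factors 1 keep the product rule in the shape of a linear combination, as in \<open>Ck_lincomb\<close>.\<close>

lemma DERIV_D_mult:
  assumes "Ck (Suc n) f" "Ck (Suc n) g"
  shows "((\<lambda>s. f (s, y2) * g (s, y2)) has_real_derivative 1 * (D1 f (y1, y2) * g (y1, y2)) + 1 * (f (y1, y2) * D1 g (y1, y2))) (at y1)"
    and "((\<lambda>s. f (y1, s) * g (y1, s)) has_real_derivative 1 * (D2 f (y1, y2) * g (y1, y2)) + 1 * (f (y1, y2) * D2 g (y1, y2))) (at y2)"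
  using DERIV_mult[OF DERIV_D1[OF assms(1), of y2 y1] DERIV_D1[OF assms(2), of y2 y1]]
    DERIV_mult[OF DERIV_D2[OF assms(1), of y1 y2] DERIV_D2[OF assms(2), of y1 y2]]
  by (simp_all add: mult.commute)

lemma D_mult:
  assumes "Ck (Suc n) f" "Ck (Suc n) g"
  shows "D1 (\<lambda>y. f y * g y) = (\<lambda>y. 1 * (D1 f y * g y) + 1 * (f y * D1 g y))"
    and "D2 (\<lambda>y. f y * g y) = (\<lambda>y. 1 * (D2 f y * g y) + 1 * (f y * D2 g y))"
  by (rule D1_eqI D2_eqI, rule DERIV_D_mult[OF assms])+

lemma Ck_mult: "Ck n f \<Longrightarrow> Ck n g \<Longrightarrow> Ck n (\<lambda>y. f y * g y)"
proof (induction n arbitrary: f g)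
  case 0
  then show ?case by (auto intro!: continuous_intros)
next
  case (Suc n)
  \<comment> \<open>The product rule also contains f and g undifferentiated, so these are needed at
    order n as well.\<close>
  note ck = Suc.prems[THEN Ck_SucD]
  have d: "Ck n (D1 f)" "Ck n (D2 f)" "Ck n (D1 g)" "Ck n (D2 g)"
    using Suc.prems by auto
  show ?case
  proof (rule Ck_SucI[OF _ DERIV_D_mult[OF Suc.prems]])
    show "continuous_on UNIV (\<lambda>y. f y * g y)"
      using Suc.prems[THEN Ck_continuous] by (intro continuous_intros)
  qed (rule Ck_lincomb Suc.IH ck d)+
qed

section \<open>Periodicity and zero average\<close>

lemma biperiodicD:
  assumes "biperiodic f"
  shows "f (y1 + 2, y2) = f (y1, y2)" "f (y1, y2 + 2) = f (y1, y2)"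
  using assms by (auto simp: biperiodic_def)

text \<open>The same numbers D qualify as derivative at x + c and at x, so the choice made by
  \<open>deriv\<close> agrees at both points, whether or not a derivative exists.\<close>

lemma DERIV_periodic_shift:
  fixes p :: "real \<Rightarrow> real"
  assumes "\<And>x. p (x + c) = p x"
  shows "deriv p (x + c) = deriv p x"
proof -
  have "(p has_real_derivative D) (at (x + c)) \<longleftrightarrow> (p has_real_derivative D) (at x)" for D
    using DERIV_shift[of p D x c] assms by simp
  then show ?thesis by (simp add: deriv_def)
qed

lemma biperiodic_D:
  assumes "biperiodic f"
  shows "biperiodic (D1 f)" "biperiodic (D2 f)"
  using assms DERIV_periodic_shift[of "\<lambda>s. f (s, _)" 2] DERIV_periodic_shift[of "\<lambda>s. f (_, s)" 2]
  by (simp_all add: biperiodic_def D1_def D2_def)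

lemma fieldsD:
  assumes "f \<in> fields n"
  shows "Ck n f" "biperiodic f" "zero_avg1 f" "continuous_on UNIV f"
  using assms Ck_continuous by (auto simp: fields_def)

lemma fields_mono: "f \<in> fields n \<Longrightarrow> m \<le> n \<Longrightarrow> f \<in> fields m"
  using Ck_mono by (auto simp: fields_def)

lemma fields_lincomb:
  assumes "f \<in> fields n" "g \<in> fields n"
  shows "(\<lambda>y. a * f y + b * g y) \<in> fields n"
proof -
  have "((\<lambda>y1. a * f (y1, y2) + b * g (y1, y2)) has_integral a * 0 + b * 0) {-1..1}" for y2
    using assms by (intro has_integral_add has_integral_mult_right) (auto simp: fields_def zero_avg1_def)
  then show ?thesis
    using assms by (auto simp: fields_def biperiodic_def zero_avg1_def intro: Ck_lincomb)
qed

text \<open>The y1-integral of \<open>D1 f\<close> telescopes to f (1, y2) - f (-1, y2) = 0. This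
  puts the y1-derivative of u * u into \<open>fields\<close>, although u * u itself need not have
  zero average.\<close>

lemma D1_fields:
  assumes "Ck (Suc n) f" "biperiodic f"
  shows "D1 f \<in> fields n"
proof -
  have "((\<lambda>y1. D1 f (y1, y2)) has_integral f (1, y2) - f (-1, y2)) {-1..1}" for y2
    by (rule fundamental_theorem_of_calculus)
      (auto simp: has_real_derivative_iff_has_vector_derivative[symmetric]
        intro: has_field_derivative_at_within[OF DERIV_D1[OF assms(1)]])
  then have "zero_avg1 (D1 f)"
    using biperiodicD(1)[OF assms(2), of "-1"] by (simp add: zero_avg1_def)
  then show ?thesis using assms by (auto simp: fields_def biperiodic_D)
qed

text \<open>The y1-average of f vanishes identically in y2; differentiating this identity under the
  integral sign gives the zero average of \<open>D2 f\<close>.\<close>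

lemma D2_fields:
  assumes f: "f \<in> fields (Suc n)"
  shows "D2 f \<in> fields n"
proof -
  note ck = fieldsD(1)[OF f]
  have c: "continuous_on UNIV (D2 f)" using ck Ck_continuous by auto
  have "((\<lambda>s. integral (cbox (-1) 1) (\<lambda>y1. f (y1, s))) has_real_derivative
      integral (cbox (-1) 1) (\<lambda>y1. D2 f (y1, y2))) (at y2 within UNIV)" for y2
  proof (rule leibniz_rule_field_derivative)
    show "continuous_on (UNIV \<times> cbox (-1) 1) (\<lambda>(x, t). D2 f (t, x))"
      unfolding case_prod_unfold by (intro continuous_on_field[OF c] continuous_intros)
    show "(\<lambda>t. f (t, x)) integrable_on cbox (-1) 1" for x
      by (intro integrable_continuous continuous_on_field[OF fieldsD(4)[OF f]] continuous_intros)
  qed (auto intro: DERIV_D2[OF ck])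
  moreover have "integral (cbox (-1) 1) (\<lambda>y1. f (y1, s)) = 0" for s
    using fieldsD(3)[OF f] by (auto simp: zero_avg1_def)
  ultimately have "integral {-1..1} (\<lambda>y1. D2 f (y1, y2)) = 0" for y2
    by (metis (no_types, lifting) DERIV_const DERIV_unique ext interval_cbox)
  moreover have "(\<lambda>y1. D2 f (y1, y2)) integrable_on {-1..1}" for y2
    by (intro integrable_continuous_interval continuous_on_field[OF c] continuous_intros)
  ultimately have "zero_avg1 (D2 f)"
    by (metis integrable_integral zero_avg1_def)
  then show ?thesis using f ck by (auto simp: fields_def biperiodic_D)
qed

subsection \<open>The inverse of D1\<close>

text \<open>If \<open>f\<close> is the derivative of a periodic \<open>F\<close>, then integration by parts gives
  \<open>F\<close> minus its mean.\<close>

definition prim1 :: "field \<Rightarrow> field" where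
  "prim1 f = (\<lambda>(y1, y2). 1 / 2 * integral {0..2} (\<lambda>t. t * f (y1 + t, y2)))"

lemma prim1_primitive:
  assumes f: "f \<in> fields n"
  shows "((\<lambda>s. prim1 f (s, y2)) has_real_derivative f (y1, y2)) (at y1)"
    and "zero_avg1 (prim1 f)"
proof -
  have "((\<lambda>s. prim1 f (s, y2)) has_real_derivative f (y1, y2)) (at y1) \<and>
      ((\<lambda>x. prim1 f (x, y2)) has_integral 0) {-1..1}" for y1 y2
  proof -
    let ?p = "\<lambda>s. f (s, y2)"
    have c: "continuous_on UNIV ?p"
      by (intro continuous_on_field[OF fieldsD(4)[OF f]] continuous_intros)
    have p0: "integral {-1..1} ?p = 0"
      using fieldsD(3)[OF f] by (auto simp: zero_avg1_def)
    have per: "?p (x + 2) = ?p x" for x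
      by (rule biperiodicD(1)[OF fieldsD(2)[OF f]])
    obtain F where F: "\<And>x. (F has_real_derivative ?p x) (at x)"
      using antiderivative_UNIV[OF c] by metis
    have cF: "continuous_on UNIV F"
      by (rule DERIV_continuous_on[OF F])
    \<comment> \<open>The increment of F over a period is the integral of f there, which is
      zero.\<close>
    have perF: "F (x + 2) = F x" for x
    proof -
      have a: "(?p has_integral F (x + 2) - F x) {x..x + 2}"
        by (rule fundamental_theorem_of_calculus)
          (auto simp: has_real_derivative_iff_has_vector_derivative[symmetric]
            intro: has_field_derivative_at_within[OF F])
      have b: "(?p has_integral 0) {x..x + 2}"
        using has_integral_periodic_shift[of ?p "x + 2" x 0, OF c per] p0 by simp
      show ?thesis using has_integral_unique[OF a b] by simp
    qed
    define C where "C = integral {-1..1} F"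
    \<comment> \<open>Integrating t * f (x + t) by parts over [0, 2] leaves the boundary term 2 * F
      (x + 2) = 2 * F x minus the period integral C. Halving gives F minus its mean C / 2.\<close>
    have prim1: "prim1 f (x, y2) = F x - C / 2" for x
    proof -
      have D: "((\<lambda>t. t * F (x + t)) has_real_derivative F (t + x) + t * ?p (x + t)) (at t)" for t
      proof -
        have "((\<lambda>t. F (x + t)) has_real_derivative ?p (x + t)) (at t)"
          using F[of "t + x"] by (simp add: DERIV_shift add.commute[of x])
        from DERIV_mult[OF DERIV_ident this] show ?thesis by (simp add: ac_simps)
      qed
      have "((\<lambda>t. F (t + x) + t * ?p (x + t)) has_integral 2 * F (x + 2) - 0 * F (x + 0)) {0..2}"
        by (rule fundamental_theorem_of_calculus)
          (auto simp: has_real_derivative_iff_has_vector_derivative[symmetric]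
            intro: has_field_derivative_at_within[OF D])
      from has_integral_diff[OF this has_integral_periodic_shift[of F 2 0 x, OF cF perF]]
      have "((\<lambda>t. t * ?p (x + t)) has_integral 2 * F x - C) {0..2}"
        by (simp add: perF C_def)
      then show ?thesis
        by (simp add: prim1_def integral_unique field_simps)
    qed
    have "(F has_integral C) {-1..1}"
      using has_integral_periodic_shift[of F 1 "-1" 0, OF cF perF] by (simp add: C_def)
    from has_integral_diff[OF this has_integral_const_real[of "C / 2" "-1" 1]]
    have "((\<lambda>x. prim1 f (x, y2)) has_integral 0) {-1..1}" by (simp add: prim1)
    moreover have "((\<lambda>s. prim1 f (s, y2)) has_real_derivative ?p y1) (at y1)"
      unfolding prim1 using DERIV_diff[OF F[of y1] DERIV_const[of "C / 2"]] by simp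
    ultimately show ?thesis by simp
  qed
  then show "((\<lambda>s. prim1 f (s, y2)) has_real_derivative f (y1, y2)) (at y1)" "zero_avg1 (prim1 f)"
    by (auto simp: zero_avg1_def)
qed

lemma D1_prim1: "f \<in> fields n \<Longrightarrow> D1 (prim1 f) = f"
  by (rule D1_eqI) (rule prim1_primitive)

lemma continuous_prim1:
  assumes "continuous_on UNIV f"
  shows "continuous_on UNIV (prim1 f)"
proof -
  have "continuous_on UNIV (\<lambda>x. integral (cbox 0 2) (\<lambda>t. t * f (fst x + t, snd x)))"
    by (rule integral_continuous_on_param)
      (auto simp: case_prod_unfold intro!: continuous_intros continuous_on_field[OF assms])
  then show ?thesis
    by (auto simp: prim1_def case_prod_unfold intro!: continuous_intros)
qed

lemma biperiodic_prim1: "biperiodic f \<Longrightarrow> biperiodic (prim1 f)"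
proof -
  assume f: "biperiodic f"
  have "f (y1 + 2 + t, y2) = f (y1 + t, y2)" for y1 y2 t
    using biperiodicD(1)[OF f, of "y1 + t"] by (simp add: ac_simps)
  then show ?thesis by (simp add: biperiodic_def prim1_def biperiodicD(2)[OF f])
qed

lemma prim1_fields_0: "f \<in> fields n \<Longrightarrow> prim1 f \<in> fields 0"
  using prim1_primitive(2) continuous_prim1 biperiodic_prim1 by (auto simp: fields_def Ck_continuous)

text \<open>The kernel of \<open>prim1\<close> acts in y1 alone, so the y2-derivative passes under
  the integral sign.\<close>

lemma DERIV2_prim1:
  assumes f: "f \<in> fields (Suc n)"
  shows "((\<lambda>s. prim1 f (y1, s)) has_real_derivative prim1 (D2 f) (y1, y2)) (at y2)"
proof -
  note ck = fieldsD(1)[OF f]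
  have c: "continuous_on UNIV (D2 f)" using ck Ck_continuous by auto
  have "((\<lambda>s. integral (cbox 0 2) (\<lambda>t. t * f (y1 + t, s))) has_real_derivative
      integral (cbox 0 2) (\<lambda>t. t * D2 f (y1 + t, y2))) (at y2 within UNIV)"
  proof (rule leibniz_rule_field_derivative)
    show "continuous_on (UNIV \<times> cbox 0 2) (\<lambda>(x, t). t * D2 f (y1 + t, x))"
      unfolding case_prod_unfold by (intro continuous_on_field[OF c] continuous_intros)
    show "(\<lambda>t. t * f (y1 + t, x)) integrable_on cbox 0 2" for x
      by (intro integrable_continuous continuous_on_field[OF fieldsD(4)[OF f]] continuous_intros)
  qed (auto intro: DERIV_cmult DERIV_D2[OF ck])
  then show ?thesis by (auto simp: prim1_def intro: DERIV_cdivide)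
qed

lemma D2_prim1: "f \<in> fields (Suc n) \<Longrightarrow> D2 (prim1 f) = prim1 (D2 f)"
  by (rule D2_eqI) (rule DERIV2_prim1)

text \<open>The partial derivatives of \<open>prim1 f\<close> are f and \<open>prim1 (D2 f)\<close>.
  The first has order n by assumption, the second by the induction hypothesis, since
  \<open>D2 f\<close> lies in \<open>fields n\<close>.\<close>

lemma prim1_fields: "f \<in> fields n \<Longrightarrow> prim1 f \<in> fields n"
proof (induction n arbitrary: f)
  case 0
  then show ?case by (rule prim1_fields_0)
next
  case (Suc n)
  have "Ck (Suc n) (prim1 f)"
  proof (rule Ck_SucI[OF _ prim1_primitive(1)[OF Suc.prems] DERIV2_prim1[OF Suc.prems]])
    show "continuous_on UNIV (prim1 f)" using fieldsD(4) prim1_fields_0 Suc.prems by blast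
    show "Ck n f" using fieldsD(1)[OF Suc.prems] by (rule Ck_SucD)
    show "Ck n (prim1 (D2 f))" using Suc.IH[OF D2_fields[OF Suc.prems]] fieldsD(1) by blast
  qed
  then show ?case using prim1_fields_0[OF Suc.prems] by (simp add: fields_def del: Ck.simps)
qed

text \<open>For fixed y2 two primitives differ by a constant k. The integral of the difference over
  a period is both 2 * k and 0.\<close>

lemma primitive_unique:
  assumes "zero_avg1 g" "zero_avg1 h"
    and g: "\<And>y1 y2. ((\<lambda>s. g (s, y2)) has_real_derivative f (y1, y2)) (at y1)"
    and h: "\<And>y1 y2. ((\<lambda>s. h (s, y2)) has_real_derivative f (y1, y2)) (at y1)"
  shows "g = h"
proof -
  have "g (y1, y2) = h (y1, y2)" for y1 y2
  proof -
    have d: "((\<lambda>s. g (s, y2) - h (s, y2)) has_real_derivative 0) (at x)" for x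
      using DERIV_diff[OF g[of y2 x] h[of y2 x]] by simp
    define k where "k = g (y1, y2) - h (y1, y2)"
    have eq: "(\<lambda>s. g (s, y2) - h (s, y2)) = (\<lambda>_. k)"
      using DERIV_isconst_all[OF allI[OF d]] unfolding k_def by (intro ext)
    have a: "((\<lambda>s. g (s, y2) - h (s, y2)) has_integral 0 - 0) {-1..1}"
      using assms(1,2) by (intro has_integral_diff) (auto simp: zero_avg1_def)
    have b: "((\<lambda>s. g (s, y2) - h (s, y2)) has_integral 2 * k) {-1..1}"
      unfolding eq using has_integral_const_real[of k "-1" 1] by simp
    show ?thesis using has_integral_unique[OF a b] by (simp add: k_def)
  qed
  then show ?thesis by auto
qed

text \<open>Replaces the definite description in \<open>D1inv\<close> by an explicit integral, for
  which linearity, translation and commutation with \<open>D2\<close> can be computed.\<close>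

lemma D1inv_eq_prim1:
  assumes f: "f \<in> fields n"
  shows "D1inv f = prim1 f"
  unfolding D1inv_def
proof (rule the_equality)
  fix g
  assume "biperiodic g \<and> zero_avg1 g \<and>
    (\<forall>y1 y2. ((\<lambda>s. g (s, y2)) has_real_derivative f (y1, y2)) (at y1))"
  then show "g = prim1 f"
    using primitive_unique[OF _ prim1_primitive(2)[OF f] _ prim1_primitive(1)[OF f], of g] by blast
qed (simp add: prim1_primitive[OF f] biperiodic_prim1[OF fieldsD(2)[OF f]])

lemma D2_D1inv: "f \<in> fields (Suc n) \<Longrightarrow> D2 (D1inv f) = prim1 (D2 f)"
  by (simp add: D1inv_eq_prim1 D2_prim1)

lemma prim1_lincomb:
  assumes "continuous_on UNIV f" "continuous_on UNIV g"
  shows "prim1 (\<lambda>y. a * f y + b * g y) = (\<lambda>y. a * prim1 f y + b * prim1 g y)"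
proof (clarsimp simp: fun_eq_iff)
  fix y1 y2
  have i: "((\<lambda>t. t * q (y1 + t, y2)) has_integral 2 * prim1 q (y1, y2)) {0..2}"
    if "continuous_on UNIV q" for q
  proof -
    have "(\<lambda>t. t * q (y1 + t, y2)) integrable_on {0..2}"
      by (intro integrable_continuous_interval continuous_intros continuous_on_field[OF that])
    then show ?thesis using integrable_integral by (simp add: prim1_def)
  qed
  have "((\<lambda>t. a * (t * f (y1 + t, y2)) + b * (t * g (y1 + t, y2))) has_integral
      a * (2 * prim1 f (y1, y2)) + b * (2 * prim1 g (y1, y2))) {0..2}"
    by (intro has_integral_add has_integral_mult_right i assms)
  then have "((\<lambda>t. t * (a * f (y1 + t, y2) + b * g (y1 + t, y2))) has_integral
      2 * (a * prim1 f (y1, y2) + b * prim1 g (y1, y2))) {0..2}"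
    by (simp add: algebra_simps)
  then show "prim1 (\<lambda>y. a * f y + b * g y) (y1, y2) = a * prim1 f (y1, y2) + b * prim1 g (y1, y2)"
    unfolding prim1_def by (auto dest: integral_unique)
qed

section \<open>Integration by parts over the cell\<close>

lemma has_integral_Icell:
  fixes f :: field
  shows "continuous_on UNIV f \<Longrightarrow> (f has_integral integral Icell f) Icell"
  using integrable_Icell by (rule integrable_integral)

lemma integral_D1_zero:
  assumes "Ck (Suc 0) f" "biperiodic f"
  shows "integral Icell (D1 f) = 0"
proof -
  have "integral {-1..1} (\<lambda>y1. D1 f (y1, y2)) = 0" for y2
    using fieldsD(3)[OF D1_fields[OF assms]] by (auto simp: zero_avg1_def)
  then show ?thesis using integral_Icell(1)[of "D1 f"] assms by simp
qed

lemma integral_D2_zero: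
  assumes "Ck (Suc 0) f" "biperiodic f"
  shows "integral Icell (D2 f) = 0"
proof -
  have "((\<lambda>y2. D2 f (y1, y2)) has_integral f (y1, 1) - f (y1, -1)) {-1..1}" for y1
    by (rule fundamental_theorem_of_calculus)
      (auto simp: has_real_derivative_iff_has_vector_derivative[symmetric]
        intro: has_field_derivative_at_within[OF DERIV_D2[OF assms(1)]])
  from integral_unique[OF this] have "integral {-1..1} (\<lambda>y2. D2 f (y1, y2)) = 0" for y1
    using biperiodicD(2)[OF assms(2), of y1 "-1"] by simp
  then show ?thesis using integral_Icell(2)[of "D2 f"] assms by simp
qed

lemma biperiodic_mult: "biperiodic f \<Longrightarrow> biperiodic g \<Longrightarrow> biperiodic (\<lambda>y. f y * g y)"
  by (simp add: biperiodic_def)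

text \<open>A derivative of the periodic product f * g integrates to zero over the cell, so there
  are no boundary terms.\<close>

lemma integral_by_parts:
  assumes "Ck (Suc 0) f" "biperiodic f" "Ck (Suc 0) g" "biperiodic g"
  shows "integral Icell (\<lambda>y. D1 f y * g y) = - integral Icell (\<lambda>y. f y * D1 g y)"
    and "integral Icell (\<lambda>y. D2 f y * g y) = - integral Icell (\<lambda>y. f y * D2 g y)"
proof -
  note ck = Ck_mult[OF assms(1,3)] and per = biperiodic_mult[OF assms(2,4)]
  have c: "continuous_on UNIV f" "continuous_on UNIV g" "continuous_on UNIV (D1 f)"
    "continuous_on UNIV (D1 g)" "continuous_on UNIV (D2 f)" "continuous_on UNIV (D2 g)"
    using assms by auto
  have "integral Icell (\<lambda>y. D1 f y * g y + f y * D1 g y) =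
      integral Icell (\<lambda>y. D1 f y * g y) + integral Icell (\<lambda>y. f y * D1 g y)"
    by (intro integral_add integrable_Icell continuous_intros c)
  then show "integral Icell (\<lambda>y. D1 f y * g y) = - integral Icell (\<lambda>y. f y * D1 g y)"
    using integral_D1_zero[OF ck per] by (simp add: D_mult(1)[OF assms(1,3)])
  have "integral Icell (\<lambda>y. D2 f y * g y + f y * D2 g y) =
      integral Icell (\<lambda>y. D2 f y * g y) + integral Icell (\<lambda>y. f y * D2 g y)"
    by (intro integral_add integrable_Icell continuous_intros c)
  then show "integral Icell (\<lambda>y. D2 f y * g y) = - integral Icell (\<lambda>y. f y * D2 g y)"
    using integral_D2_zero[OF ck per] by (simp add: D_mult(2)[OF assms(1,3)])
qed

subsection \<open>Averaging along the flow\<close>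

text \<open>The flow of \<open>h0\<close> is \<open>shift1 (- \<tau>)\<close> on the first component
  and \<open>shift1 \<tau>\<close> on the second.\<close>

definition shift1 :: "real \<Rightarrow> field \<Rightarrow> field" where
  "shift1 c f = (\<lambda>(y1, y2). f (y1 + c, y2))"

lemma D1_shift1: "D1 (shift1 c f) = shift1 c (D1 f)"
proof -
  have "((\<lambda>s. f (s + c, y2)) has_real_derivative D) (at y1) \<longleftrightarrow>
      ((\<lambda>s. f (s, y2)) has_real_derivative D) (at (y1 + c))" for y1 y2 D
    using DERIV_shift[of "\<lambda>s. f (s, y2)" D y1 c] by simp
  then show ?thesis by (simp add: fun_eq_iff D1_def shift1_def deriv_def)
qed

lemma D2_shift1: "D2 (shift1 c f) = shift1 c (D2 f)"
  by (rule ext) (auto simp: D2_def shift1_def)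

lemma prim1_shift1: "prim1 (shift1 c f) = shift1 c (prim1 f)"
proof (rule ext, clarify)
  fix y1 y2
  have "y1 + t + c = y1 + c + t" for t by simp
  then show "prim1 (shift1 c f) (y1, y2) = shift1 c (prim1 f) (y1, y2)"
    by (simp only: prim1_def shift1_def prod.case)
qed

lemma continuous_shift1:
  assumes "continuous_on UNIV f"
  shows "continuous_on UNIV (shift1 c f)"
  unfolding shift1_def case_prod_unfold by (intro continuous_on_field[OF assms] continuous_intros)

lemma Ck_shift1: "Ck n f \<Longrightarrow> Ck n (shift1 c f)"
proof (induction n arbitrary: f)
  case 0
  then show ?case by (simp add: continuous_shift1)
next
  case (Suc n)
  show ?case
  proof (rule Ck_SucI)
    show "Ck n (shift1 c (D1 f))" "Ck n (shift1 c (D2 f))" "continuous_on UNIV (shift1 c f)"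
      using Suc by (auto intro: continuous_shift1)
    show "((\<lambda>s. shift1 c f (s, y2)) has_real_derivative shift1 c (D1 f) (y1, y2)) (at y1)" for y1 y2
      using DERIV_D1[OF Suc.prems, of y2 "y1 + c"] by (simp add: shift1_def DERIV_shift)
    show "((\<lambda>s. shift1 c f (y1, s)) has_real_derivative shift1 c (D2 f) (y1, y2)) (at y2)" for y1 y2
      using DERIV_D2[OF Suc.prems, of "y1 + c" y2] by (simp add: shift1_def)
  qed
qed

lemma biperiodic_shift1: "biperiodic f \<Longrightarrow> biperiodic (shift1 c f)"
proof -
  assume f: "biperiodic f"
  have "f (y1 + 2 + c, y2) = f (y1 + c, y2)" for y1 y2
    using biperiodicD(1)[OF f, of "y1 + c"] by (simp add: ac_simps)
  then show ?thesis by (simp add: biperiodic_def shift1_def biperiodicD(2)[OF f])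
qed

lemma has_integral_shift1:
  assumes "continuous_on UNIV f" "biperiodic f"
  shows "((\<lambda>y1. shift1 c f (y1, y2)) has_integral integral {-1..1} (\<lambda>y1. f (y1, y2))) {-1..1}"
proof -
  have "continuous_on UNIV (\<lambda>y1. f (y1, y2))"
    by (intro continuous_on_field[OF assms(1)] continuous_intros)
  from has_integral_periodic_shift[of "\<lambda>y1. f (y1, y2)" 1 "-1" c, OF this biperiodicD(1)[OF assms(2)]]
  show ?thesis by (simp add: shift1_def)
qed

lemma shift1_fields:
  assumes "f \<in> fields n"
  shows "shift1 c f \<in> fields n"
proof -
  have "integral {-1..1} (\<lambda>y1. f (y1, y2)) = 0" for y2
    using fieldsD(3)[OF assms] by (auto simp: zero_avg1_def)
  then have "zero_avg1 (shift1 c f)"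
    using has_integral_shift1[OF fieldsD(4)[OF assms] fieldsD(2)[OF assms], of c] by (simp add: zero_avg1_def)
  then show ?thesis
    using assms Ck_shift1 biperiodic_shift1 by (simp add: fields_def)
qed

lemma integral_shift1:
  assumes "continuous_on UNIV f" "biperiodic f"
  shows "integral Icell (shift1 c f) = integral Icell f"
  unfolding integral_Icell(1)[OF continuous_shift1[OF assms(1)]] integral_Icell(1)[OF assms(1)]
  by (simp add: integral_unique[OF has_integral_shift1[OF assms]])

text \<open>The constant c is the relative speed of the two counter-propagating components. During
  the time interval [0, 2] the argument of the antiderivative \<open>prim1 f\<close> moves by 4 in
  absolute value, two full periods, so its end values coincide.\<close>

lemma has_integral_shift_period:
  assumes f: "f \<in> fields n" and c: "c = 2 \<or> c = -2"
  shows "((\<lambda>\<tau>. f (y1 + c * \<tau>, y2)) has_integral 0) {0..2}"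
proof -
  have "((\<lambda>\<tau>. prim1 f (y1 + c * \<tau>, y2) / c) has_real_derivative f (y1 + c * \<tau>, y2)) (at \<tau>)" for \<tau>
  proof -
    have "((\<lambda>\<tau>. y1 + c * \<tau>) has_real_derivative c) (at \<tau>)"
      by (auto intro!: derivative_eq_intros)
    from DERIV_cdivide[OF DERIV_chain2[OF prim1_primitive(1)[OF f] this], of y2 c] c
    show ?thesis by auto
  qed
  then have "((\<lambda>\<tau>. f (y1 + c * \<tau>, y2)) has_integral
      prim1 f (y1 + c * 2, y2) / c - prim1 f (y1 + c * 0, y2) / c) {0..2}"
    by (intro fundamental_theorem_of_calculus)
      (simp_all add: has_real_derivative_iff_has_vector_derivative[symmetric]
        has_field_derivative_at_within)
  moreover have per: "prim1 f (x + 2, y2) = prim1 f (x, y2)" for x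
    by (rule biperiodicD(1)[OF biperiodic_prim1[OF fieldsD(2)[OF f]]])
  have "prim1 f (y1 + c * 2, y2) = prim1 f (y1, y2)"
    using c per[of y1] per[of "y1 + 2"] per[of "y1 - 2"] per[of "y1 - 4"]
    by (auto simp: add.assoc)
  ultimately show ?thesis by simp
qed

text \<open>Translating the integration variable freezes one factor and moves the other by twice
  \<tau>. After exchanging the integrals, the time integral of the moving factor vanishes at every
  y. The direction of the translation is chosen so that the moving factor is the one with zero
  average.\<close>

lemma has_integral_cross:
  assumes A: "continuous_on UNIV A" "biperiodic A" and B: "continuous_on UNIV B" "biperiodic B"
    and AB: "A \<in> fields 0 \<or> B \<in> fields 0"
  shows "((\<lambda>\<tau>. integral Icell (\<lambda>y. shift1 (- \<tau>) A y * shift1 \<tau> B y)) has_integral 0) {0..2}"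
proof -
  have main: "((\<lambda>\<tau>. integral Icell (\<lambda>y. f y * shift1 (c * \<tau>) g y)) has_integral 0) {0..2}"
    if f: "continuous_on UNIV f" and g: "g \<in> fields 0" and c: "c = 2 \<or> c = -2" for f g c
  proof -
    have I: "Icell = cbox (-1, -1) (1, 1)"
      by (simp add: Icell_def cbox_Pair_eq)
    let ?h = "\<lambda>\<tau> y. f y * shift1 (c * \<tau>) g y"
    have cont: "continuous_on S (\<lambda>(\<tau>, y). ?h \<tau> y)" for S
      unfolding case_prod_unfold shift1_def
      by (intro continuous_intros continuous_on_field[OF fieldsD(4)[OF g]]
          continuous_on_compose2[OF f]) auto
    have "integral (cbox 0 2) (\<lambda>\<tau>. integral Icell (?h \<tau>)) =
        integral Icell (\<lambda>y. integral (cbox 0 2) (\<lambda>\<tau>. ?h \<tau> y))"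
      unfolding I by (rule integral_swap_continuous[OF cont])
    moreover have "integral (cbox 0 2) (\<lambda>\<tau>. ?h \<tau> y) = 0" for y
    proof (rule integral_unique)
      show "((\<lambda>\<tau>. ?h \<tau> y) has_integral 0) (cbox 0 2)"
        using has_integral_mult_right[OF has_integral_shift_period[OF g c], of "f y" "fst y" "snd y"]
        by (simp add: shift1_def case_prod_unfold)
    qed
    \<comment> \<open>The value 0 of \<open>integral\<close> is also the default for non-integrable
      functions, so \<open>has_integral\<close> needs integrability as well.\<close>
    moreover have "(\<lambda>\<tau>. integral Icell (?h \<tau>)) integrable_on cbox 0 2"
      unfolding I by (intro integrable_continuous integral_continuous_on_param cont)
    ultimately show ?thesis
      by (metis (no_types, lifting) box_real(2) has_integral_integral integral_0 integral_cong)
  qed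
  have sh: "integral Icell (\<lambda>y. shift1 (- \<tau>) A y * shift1 \<tau> B y) =
      integral Icell (shift1 s (\<lambda>y. shift1 (- \<tau>) A y * shift1 \<tau> B y))" for \<tau> s
    by (rule integral_shift1[symmetric])
      (intro continuous_intros continuous_shift1 biperiodic_mult biperiodic_shift1 assms)+
  from AB show ?thesis
  proof
    have e: "shift1 \<tau> (\<lambda>y. shift1 (- \<tau>) A y * shift1 \<tau> B y) = (\<lambda>y. A y * shift1 (2 * \<tau>) B y)" for \<tau>
      by (simp add: fun_eq_iff shift1_def algebra_simps)
    assume "B \<in> fields 0"
    from main[OF A(1) this, of 2] show ?thesis
      unfolding sh[of \<tau> \<tau> for \<tau>] e by simp
  next
    have e: "shift1 (- \<tau>) (\<lambda>y. shift1 (- \<tau>) A y * shift1 \<tau> B y) = (\<lambda>y. B y * shift1 (- 2 * \<tau>) A y)" for \<tau>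
      by (simp add: fun_eq_iff shift1_def algebra_simps)
    assume "A \<in> fields 0"
    from main[OF B(1) this, of "-2"] show ?thesis
      unfolding sh[of \<tau> "- \<tau>" for \<tau>] e by simp
  qed
qed

text \<open>For w in \<open>fields 1\<close> this is \<open>F1\<close> with one component set to
  zero and \<beta> = \<alpha> / 2 powr (3/2). The nonlocal factor is written with \<open>D2\<close>
  inside \<open>prim1\<close>, which agrees with \<open>D2 (D1inv w)\<close> by
  \<open>D2_D1inv\<close>.\<close>

definition potential :: "real \<Rightarrow> field \<Rightarrow> real" where
  "potential \<beta> w = integral Icell
     (\<lambda>y. - (D1 w y)\<^sup>2 / 48 + (prim1 (D2 w) y)\<^sup>2 / 4 + \<beta> / 3 * w y ^ 3)"

lemma continuous_fields_1:
  assumes "w \<in> fields (Suc 0)"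
  shows "continuous_on UNIV w" "continuous_on UNIV (D1 w)" "continuous_on UNIV (prim1 (D2 w))"
  using fieldsD[OF assms] continuous_prim1 by auto

lemma flow_average_F1:
  assumes u: "u \<in> fields (Suc 0)" and v: "v \<in> fields (Suc 0)"
  shows "flow_average (F1 \<alpha>) u v = potential (\<alpha> / (2 * sqrt 2)) u + potential (\<alpha> / (2 * sqrt 2)) v"
proof -
  define \<beta> where "\<beta> = \<alpha> / (2 * sqrt 2)"
  have "2 powr (3 / 2) = 2 * sqrt (2::real)"
    using powr_add[of 2 1 "1 / 2 :: real"] by (simp add: powr_half_sqrt)
  then have \<alpha>: "\<alpha> * x / (3 * 2 powr (3 / 2)) = \<beta> / 3 * x" for x
    by (simp add: \<beta>_def)
  let ?q = "\<lambda>w y. - (D1 w y)\<^sup>2 / 48 + (prim1 (D2 w) y)\<^sup>2 / 4 + \<beta> / 3 * w y ^ 3"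
  let ?X = "\<lambda>A B \<tau>. integral Icell (\<lambda>y. shift1 (- \<tau>) A y * shift1 \<tau> B y)"
  note cu = continuous_fields_1[OF u] and cv = continuous_fields_1[OF v]
  have D2: "D2 u \<in> fields 0" "D2 v \<in> fields 0"
    using D2_fields u v by auto
  have D1: "D1 u \<in> fields 0" "D1 v \<in> fields 0"
    using D1_fields[OF fieldsD(1)[OF u] fieldsD(2)[OF u]] D1_fields[OF fieldsD(1)[OF v] fieldsD(2)[OF v]] by auto
  have per: "biperiodic u" "biperiodic v" "biperiodic (D1 u)" "biperiodic (D1 v)"
    "biperiodic (prim1 (D2 u))" "biperiodic (prim1 (D2 v))"
    using fieldsD(2) u v D1 D2 biperiodic_prim1 by auto
  \<comment> \<open>Expansion of the two squares and the cube. The unmixed terms are translation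
    invariant and form the potentials; the mixed ones carry the coefficients 2/48, -2/4 and 3 *
    \<beta>/3. Each mixed product has a factor of zero average: in the cubic terms it is the factor
    that occurs to the first power.\<close>
  have F1: "case_prod (F1 \<alpha>) (h0_flow \<tau> u v) =
      potential \<beta> u + potential \<beta> v + 1 / 24 * ?X (D1 u) (D1 v) \<tau> +
      (- 1 / 2) * ?X (prim1 (D2 u)) (prim1 (D2 v)) \<tau> + \<beta> * ?X (\<lambda>y. u y * u y) v \<tau> + \<beta> * ?X u (\<lambda>y. v y * v y) \<tau>" for \<tau>
  proof -
    let ?u = "shift1 (- \<tau>) u" and ?v = "shift1 \<tau> v"
    have su: "?u \<in> fields (Suc 0)" and sv: "?v \<in> fields (Suc 0)"
      using u v by (simp_all add: shift1_fields)
    have w: "(\<lambda>z. ?u z - ?v z) = (\<lambda>z. 1 * ?u z + (- 1) * ?v z)"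
      by simp
    have d1: "D1 (\<lambda>z. ?u z - ?v z) y = shift1 (- \<tau>) (D1 u) y - shift1 \<tau> (D1 v) y" for y
      unfolding w D_lincomb[OF fieldsD(1)[OF su] fieldsD(1)[OF sv]] by (simp add: D1_shift1)
    have cs: "continuous_on UNIV (D2 ?u)" "continuous_on UNIV (D2 ?v)"
      using fieldsD(1)[OF su] fieldsD(1)[OF sv] by auto
    have d2: "D2 (D1inv (\<lambda>z. ?u z - ?v z)) y =
        shift1 (- \<tau>) (prim1 (D2 u)) y - shift1 \<tau> (prim1 (D2 v)) y" for y
      unfolding w D2_D1inv[OF fields_lincomb[OF su sv]]
        D_lincomb[OF fieldsD(1)[OF su] fieldsD(1)[OF sv]] prim1_lincomb[OF cs]
      by (simp add: D2_shift1 prim1_shift1)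
    have "F1 \<alpha> ?u ?v = integral Icell (\<lambda>y. shift1 (- \<tau>) (?q u) y + shift1 \<tau> (?q v) y
        + 1 / 24 * (shift1 (- \<tau>) (D1 u) y * shift1 \<tau> (D1 v) y)
        + (- 1 / 2) * (shift1 (- \<tau>) (prim1 (D2 u)) y * shift1 \<tau> (prim1 (D2 v)) y)
        + \<beta> * (shift1 (- \<tau>) (\<lambda>y. u y * u y) y * ?v y)
        + \<beta> * (?u y * shift1 \<tau> (\<lambda>y. v y * v y) y))"
      unfolding F1_def d1 d2 \<alpha>
      by (intro arg_cong[where f = "integral Icell"] ext)
        (simp add: shift1_def case_prod_unfold power2_eq_square power3_eq_cube field_simps)
    also have "\<dots> = integral Icell (shift1 (- \<tau>) (?q u)) + integral Icell (shift1 \<tau> (?q v)) +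
        1 / 24 * ?X (D1 u) (D1 v) \<tau> + (- 1 / 2) * ?X (prim1 (D2 u)) (prim1 (D2 v)) \<tau> +
        \<beta> * ?X (\<lambda>y. u y * u y) v \<tau> + \<beta> * ?X u (\<lambda>y. v y * v y) \<tau>"
      by (intro integral_unique has_integral_add has_integral_mult_right has_integral_Icell
          continuous_intros continuous_shift1 cu cv) auto
    also have "integral Icell (shift1 (- \<tau>) (?q u)) = potential \<beta> u"
      unfolding potential_def
      by (intro integral_shift1 continuous_intros cu) (use per in \<open>auto simp: biperiodic_def\<close>)
    also have "integral Icell (shift1 \<tau> (?q v)) = potential \<beta> v"
      unfolding potential_def
      by (intro integral_shift1 continuous_intros cv) (use per in \<open>auto simp: biperiodic_def\<close>)
    finally show ?thesis
      by (simp add: h0_flow_def shift1_def)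
  qed
  have "((\<lambda>\<tau>. case_prod (F1 \<alpha>) (h0_flow \<tau> u v)) has_integral
      (2 * (potential \<beta> u + potential \<beta> v) + 1 / 24 * 0 + (- 1 / 2) * 0 + \<beta> * 0 + \<beta> * 0)) {0..2}"
    unfolding F1
  proof (intro has_integral_add[OF has_integral_add] has_integral_add has_integral_mult_right has_integral_cross)
    show "((\<lambda>\<tau>. potential \<beta> u + potential \<beta> v) has_integral 2 * (potential \<beta> u + potential \<beta> v)) {0..2::real}"
      using has_integral_const_real[of "potential \<beta> u + potential \<beta> v" 0 2] by simp
  qed (use u v D1 D2 prim1_fields cu cv per biperiodic_mult in \<open>auto intro!: continuous_intros intro: fields_mono\<close>)
  then show ?thesis
    unfolding flow_average_def \<beta>_def[symmetric] by (auto dest: integral_unique)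
qed

subsection \<open>The gradient of the averaged Hamiltonian\<close>

definition energy :: "real \<Rightarrow> real \<Rightarrow> field \<Rightarrow> real" where
  "energy \<beta> \<mu> w = integral Icell (\<lambda>y. (w y)\<^sup>2 / 2) + \<mu>\<^sup>2 * potential \<beta> w"

text \<open>No term couples u and v any more, which is why the two equations of motion
  decouple.\<close>

lemma averaged_hamiltonian_energy:
  assumes u: "u \<in> fields (Suc 0)" and v: "v \<in> fields (Suc 0)"
  shows "averaged_hamiltonian \<alpha> \<mu> u v = energy (\<alpha> / (2 * sqrt 2)) \<mu> u + energy (\<alpha> / (2 * sqrt 2)) \<mu> v"
proof -
  have "h0 u v = integral Icell (\<lambda>y. (u y)\<^sup>2 / 2 + (v y)\<^sup>2 / 2)"
    by (simp add: h0_def add_divide_distrib)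
  also have "\<dots> = integral Icell (\<lambda>y. (u y)\<^sup>2 / 2) + integral Icell (\<lambda>y. (v y)\<^sup>2 / 2)"
    by (intro integral_add integrable_Icell continuous_intros fieldsD(4)[OF u] fieldsD(4)[OF v]) auto
  finally show ?thesis
    unfolding averaged_hamiltonian_def energy_def flow_average_F1[OF u v] by (simp add: algebra_simps)
qed

text \<open>Reduces each variation to reading off a linear coefficient, without differentiating
  under an integral in \<epsilon>.\<close>

lemma DERIV_poly3_at_0:
  "((\<lambda>\<epsilon>::real. a + \<epsilon> * b + \<epsilon>\<^sup>2 * c + \<epsilon> ^ 3 * d) has_real_derivative b) (at 0)"
  by (auto intro!: derivative_eq_intros)

text \<open>\<open>D1\<close> and \<open>prim1\<close> after \<open>D2\<close> are linear, so the
  integrand at u + \<epsilon> h is a cubic polynomial in \<epsilon>. The derivative is left in weak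
  form, because u has only one derivative here.\<close>

lemma DERIV_potential:
  assumes u: "u \<in> fields (Suc 0)" and h: "h \<in> fields (Suc 0)"
  shows "((\<lambda>\<epsilon>. potential \<beta> (\<lambda>y. u y + \<epsilon> * h y)) has_real_derivative
    - 1 / 24 * integral Icell (\<lambda>y. D1 u y * D1 h y) + 1 / 2 * integral Icell (\<lambda>y. prim1 (D2 u) y * prim1 (D2 h) y)
    + \<beta> * integral Icell (\<lambda>y. u y * u y * h y)) (at 0)"
proof -
  note cu = continuous_fields_1[OF u] and ch = continuous_fields_1[OF h]
  have cd: "continuous_on UNIV (D2 u)" "continuous_on UNIV (D2 h)"
    using fieldsD(1)[OF u] fieldsD(1)[OF h] by auto
  let ?a = "integral Icell (\<lambda>y. - (D1 u y)\<^sup>2 / 48 + (prim1 (D2 u) y)\<^sup>2 / 4 + \<beta> / 3 * u y ^ 3)"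
  let ?c = "integral Icell (\<lambda>y. - (D1 h y)\<^sup>2 / 48 + (prim1 (D2 h) y)\<^sup>2 / 4 + \<beta> * u y * (h y)\<^sup>2)"
  let ?d = "integral Icell (\<lambda>y. \<beta> / 3 * h y ^ 3)"
  let ?b = "- 1 / 24 * integral Icell (\<lambda>y. D1 u y * D1 h y) + 1 / 2 * integral Icell (\<lambda>y. prim1 (D2 u) y * prim1 (D2 h) y)
    + \<beta> * integral Icell (\<lambda>y. u y * u y * h y)"
  have "potential \<beta> (\<lambda>y. u y + \<epsilon> * h y) = ?a + \<epsilon> * ?b + \<epsilon>\<^sup>2 * ?c + \<epsilon> ^ 3 * ?d" for \<epsilon>
  proof -
    have w: "(\<lambda>y. u y + \<epsilon> * h y) = (\<lambda>y. 1 * u y + \<epsilon> * h y)"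
      by simp
    have "potential \<beta> (\<lambda>y. u y + \<epsilon> * h y) = integral Icell (\<lambda>y.
        (- (D1 u y)\<^sup>2 / 48 + (prim1 (D2 u) y)\<^sup>2 / 4 + \<beta> / 3 * u y ^ 3)
        + \<epsilon> * (- 1 / 24 * (D1 u y * D1 h y) + 1 / 2 * (prim1 (D2 u) y * prim1 (D2 h) y) + \<beta> * (u y * u y * h y))
        + \<epsilon>\<^sup>2 * (- (D1 h y)\<^sup>2 / 48 + (prim1 (D2 h) y)\<^sup>2 / 4 + \<beta> * u y * (h y)\<^sup>2)
        + \<epsilon> ^ 3 * (\<beta> / 3 * h y ^ 3))"
      unfolding potential_def w D_lincomb[OF fieldsD(1)[OF u] fieldsD(1)[OF h]] prim1_lincomb[OF cd]
      by (intro arg_cong[where f = "integral Icell"] ext)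
        (simp add: power2_eq_square power3_eq_cube field_simps)
    also have "\<dots> = ?a + \<epsilon> * ?b + \<epsilon>\<^sup>2 * ?c + \<epsilon> ^ 3 * ?d"
      by (intro integral_unique has_integral_add[OF has_integral_add[OF has_integral_add]]
          has_integral_mult_right has_integral_Icell continuous_intros cu ch
          has_integral_add[OF has_integral_add[OF has_integral_mult_right has_integral_mult_right] has_integral_mult_right]) auto
    finally show ?thesis .
  qed
  then show ?thesis using DERIV_poly3_at_0[of ?a ?b ?c ?d] by simp
qed

lemma DERIV_kinetic:
  assumes u: "u \<in> fields n" and h: "h \<in> fields n"
  shows "((\<lambda>\<epsilon>. integral Icell (\<lambda>y. (u y + \<epsilon> * h y)\<^sup>2 / 2)) has_real_derivative
    integral Icell (\<lambda>y. u y * h y)) (at 0)"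
proof -
  note cu = fieldsD(4)[OF u] and ch = fieldsD(4)[OF h]
  \<comment> \<open>The vanishing cubic term gives the expression the shape of
    \<open>DERIV_poly3_at_0\<close>.\<close>
  have e: "integral Icell (\<lambda>y. (u y + \<epsilon> * h y)\<^sup>2 / 2) = integral Icell (\<lambda>y. (u y)\<^sup>2 / 2)
    + \<epsilon> * integral Icell (\<lambda>y. u y * h y) + \<epsilon>\<^sup>2 * integral Icell (\<lambda>y. (h y)\<^sup>2 / 2) + \<epsilon> ^ 3 * 0" for \<epsilon>
  proof -
    have "integral Icell (\<lambda>y. (u y + \<epsilon> * h y)\<^sup>2 / 2) =
        integral Icell (\<lambda>y. (u y)\<^sup>2 / 2 + \<epsilon> * (u y * h y) + \<epsilon>\<^sup>2 * ((h y)\<^sup>2 / 2))"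
      by (intro arg_cong[where f = "integral Icell"] ext) (simp add: power2_eq_square field_simps)
    also have "\<dots> = integral Icell (\<lambda>y. (u y)\<^sup>2 / 2) + \<epsilon> * integral Icell (\<lambda>y. u y * h y)
        + \<epsilon>\<^sup>2 * integral Icell (\<lambda>y. (h y)\<^sup>2 / 2)"
      by (intro integral_unique has_integral_add[OF has_integral_add]
          has_integral_mult_right has_integral_Icell continuous_intros cu ch) auto
    finally show ?thesis by simp
  qed
  show ?thesis unfolding e by (rule DERIV_poly3_at_0)
qed

text \<open>\<open>prim1 (D1 (u\<^sup>2))\<close> is \<open>u\<^sup>2\<close> minus its \<open>y1\<close>-average. The factors 1 keep the nested
  linear combinations in the shape of \<open>D_lincomb\<close> and \<open>fields_lincomb\<close>.\<close>

definition energy_gradient :: "real \<Rightarrow> real \<Rightarrow> field \<Rightarrow> field" where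
  "energy_gradient \<beta> \<mu> u = (\<lambda>y. 1 * u y + \<mu>\<^sup>2 * (1 * (1 / 24 * D1 (D1 u) y + 1 / 2 * prim1 (prim1 (D2 (D2 u))) y)
     + \<beta> * prim1 (D1 (\<lambda>z. u z * u z)) y))"

context
  fixes u :: field
  assumes u: "u \<in> fields 3"
begin

text \<open>Three derivatives of u leave its second derivatives in \<open>fields (Suc 0)\<close>,
  the class in which a variational derivative must lie.\<close>

lemma derivatives_fields:
  "u \<in> fields (Suc 0)" "D1 (D1 u) \<in> fields (Suc 0)" "D2 (D2 u) \<in> fields (Suc 0)"
  "D1 (\<lambda>z. u z * u z) \<in> fields (Suc 0)" "D1 u \<in> fields (Suc 0)" "D2 u \<in> fields (Suc 0)"
proof -
  have u3: "u \<in> fields (Suc (Suc (Suc 0)))"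
    using u by (simp add: numeral_3_eq_3)
  have D: "D1 f \<in> fields n" if "f \<in> fields (Suc n)" for f n
    using D1_fields[OF fieldsD(1)[OF that] fieldsD(2)[OF that]] .
  show "u \<in> fields (Suc 0)" "D1 u \<in> fields (Suc 0)" "D2 u \<in> fields (Suc 0)"
    using fields_mono[OF u3] fields_mono[OF D[OF u3]] fields_mono[OF D2_fields[OF u3]] by simp_all
  show "D1 (D1 u) \<in> fields (Suc 0)" "D2 (D2 u) \<in> fields (Suc 0)"
    by (rule D D2_fields u3)+
  show "D1 (\<lambda>z. u z * u z) \<in> fields (Suc 0)"
    using fieldsD(1)[OF u3] fieldsD(2)[OF u3]
    by (intro D1_fields Ck_mult biperiodic_mult) (auto dest: Ck_SucD simp del: Ck.simps)
qed

lemma energy_gradient_fields: "energy_gradient \<beta> \<mu> u \<in> fields (Suc 0)"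
  unfolding energy_gradient_def by (intro fields_lincomb derivatives_fields prim1_fields)

text \<open>\<open>D1\<close> cancels the outer \<open>prim1\<close> in both nonlocal terms. In the
  quadratic term this restores the y1-derivative of u * u itself: the subtracted average depends on
  y2 alone.\<close>

lemma D1_energy_gradient:
  "D1 (energy_gradient \<beta> \<mu> u) y = D1 u y + \<mu>\<^sup>2 / 24 * D1 (D1 (D1 u)) y
     + \<mu>\<^sup>2 / 2 * D1inv (D2 (D2 u)) y + \<beta> * \<mu>\<^sup>2 * D1 (\<lambda>z. (u z)\<^sup>2) y"
proof -
  note ck = derivatives_fields[THEN fieldsD(1)] derivatives_fields[THEN prim1_fields, THEN fieldsD(1)]
    derivatives_fields[THEN prim1_fields, THEN prim1_fields, THEN fieldsD(1)]
  have "D1 (energy_gradient \<beta> \<mu> u) = (\<lambda>y. 1 * D1 u y + \<mu>\<^sup>2 * (1 * (1 / 24 * D1 (D1 (D1 u)) y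
      + 1 / 2 * D1 (prim1 (prim1 (D2 (D2 u)))) y) + \<beta> * D1 (prim1 (D1 (\<lambda>z. u z * u z))) y))"
    unfolding energy_gradient_def by (simp only: D_lincomb(1)[of 0] Ck_lincomb ck)
  then show ?thesis
    by (simp add: D1_prim1[OF derivatives_fields(4)] D1_prim1[OF prim1_fields[OF derivatives_fields(3)]] D1inv_eq_prim1[OF derivatives_fields(3)]
        power2_eq_square algebra_simps)
qed

text \<open>Turns the weak form of \<open>DERIV_potential\<close> into a pairing with h. The local
  term takes one integration by parts, the other two start from h =
  \<open>D1 (prim1 h)\<close>.\<close>

lemma integral_energy_gradient:
  assumes h: "h \<in> fields (Suc 0)"
  shows "integral Icell (\<lambda>y. energy_gradient \<beta> \<mu> u y * h y) = integral Icell (\<lambda>y. u y * h y) +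
    \<mu>\<^sup>2 * (- 1 / 24 * integral Icell (\<lambda>y. D1 u y * D1 h y) + 1 / 2 * integral Icell (\<lambda>y. prim1 (D2 u) y * prim1 (D2 h) y)
    + \<beta> * integral Icell (\<lambda>y. u y * u y * h y))"
proof -
  note F = fieldsD(1,2)
  note Jh = prim1_fields[OF h]
  have ibp1: "integral Icell (\<lambda>y. D1 f y * g y) = - integral Icell (\<lambda>y. f y * D1 g y)"
    and ibp2: "integral Icell (\<lambda>y. D2 f y * g y) = - integral Icell (\<lambda>y. f y * D2 g y)"
    if "f \<in> fields (Suc 0)" "g \<in> fields (Suc 0)" for f g
    using integral_by_parts[OF F[OF that(1)] F[OF that(2)]] .
  \<comment> \<open>Since u * u need not have zero average, \<open>ibp1\<close> does not cover it;
    \<open>integral_by_parts\<close> asks for regularity and periodicity only.\<close>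
  have uu: "Ck (Suc 0) (\<lambda>y. u y * u y)" "biperiodic (\<lambda>y. u y * u y)"
    using derivatives_fields(1) by (auto intro: Ck_mult biperiodic_mult dest: F simp del: Ck.simps)
  have i1: "integral Icell (\<lambda>y. D1 (D1 u) y * h y) = - integral Icell (\<lambda>y. D1 u y * D1 h y)"
    by (rule ibp1[OF derivatives_fields(5) h])
  \<comment> \<open>Moving \<open>D1\<close> to the left removes one \<open>prim1\<close>; then one
    \<open>D2\<close> is pulled out and moved to the right. The two signs cancel, and the form
    becomes symmetric in u and h.\<close>
  have "integral Icell (\<lambda>y. prim1 (prim1 (D2 (D2 u))) y * D1 (prim1 h) y) =
      - integral Icell (\<lambda>y. D1 (prim1 (prim1 (D2 (D2 u)))) y * prim1 h y)"
    using ibp1[OF prim1_fields[OF prim1_fields[OF derivatives_fields(3)]] Jh] by simp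
  also have "\<dots> = - integral Icell (\<lambda>y. D2 (prim1 (D2 u)) y * prim1 h y)"
    by (simp add: D1_prim1[OF prim1_fields[OF derivatives_fields(3)]] D2_prim1[OF derivatives_fields(6)])
  also have "\<dots> = integral Icell (\<lambda>y. prim1 (D2 u) y * D2 (prim1 h) y)"
    using ibp2[OF prim1_fields[OF derivatives_fields(6)] Jh] by simp
  finally have i2: "integral Icell (\<lambda>y. prim1 (prim1 (D2 (D2 u))) y * h y) = integral Icell (\<lambda>y. prim1 (D2 u) y * prim1 (D2 h) y)"
    by (simp add: D1_prim1[OF h] D2_prim1[OF h])
  have "integral Icell (\<lambda>y. prim1 (D1 (\<lambda>z. u z * u z)) y * D1 (prim1 h) y) =
      - integral Icell (\<lambda>y. D1 (\<lambda>z. u z * u z) y * prim1 h y)"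
    using ibp1[OF prim1_fields[OF derivatives_fields(4)] Jh] by (simp add: D1_prim1[OF derivatives_fields(4)])
  also have "\<dots> = integral Icell (\<lambda>y. u y * u y * D1 (prim1 h) y)"
    using integral_by_parts(1)[OF uu F[OF Jh]] by simp
  finally have i3: "integral Icell (\<lambda>y. prim1 (D1 (\<lambda>z. u z * u z)) y * h y) = integral Icell (\<lambda>y. u y * u y * h y)"
    by (simp add: D1_prim1[OF h])
  note c = derivatives_fields[THEN fieldsD(4)] derivatives_fields[THEN prim1_fields, THEN fieldsD(4)]
    derivatives_fields[THEN prim1_fields, THEN prim1_fields, THEN fieldsD(4)] fieldsD(4)[OF h]
  have "integral Icell (\<lambda>y. energy_gradient \<beta> \<mu> u y * h y) = integral Icell (\<lambda>y. u y * h y +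
      \<mu>\<^sup>2 * (1 / 24 * (D1 (D1 u) y * h y) + 1 / 2 * (prim1 (prim1 (D2 (D2 u))) y * h y)
      + \<beta> * (prim1 (D1 (\<lambda>z. u z * u z)) y * h y)))"
    unfolding energy_gradient_def
    by (intro arg_cong[where f = "integral Icell"] ext) (simp add: algebra_simps)
  also have "\<dots> = integral Icell (\<lambda>y. u y * h y) +
      \<mu>\<^sup>2 * (1 / 24 * integral Icell (\<lambda>y. D1 (D1 u) y * h y)
      + 1 / 2 * integral Icell (\<lambda>y. prim1 (prim1 (D2 (D2 u))) y * h y)
      + \<beta> * integral Icell (\<lambda>y. prim1 (D1 (\<lambda>z. u z * u z)) y * h y))"
    by (intro integral_unique has_integral_add has_integral_mult_right has_integral_Icell
        continuous_intros c)
  finally show ?thesis unfolding i1 i2 i3 by simp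
qed

text \<open>The constant k stands for the energy of the component that is held fixed. Agreement on
  \<open>fields (Suc 0)\<close> suffices, since u + \<epsilon> h stays in that space for every
  admissible variation h.\<close>

lemma has_variational_derivative_energy:
  assumes F: "\<And>w. w \<in> fields (Suc 0) \<Longrightarrow> F w = energy \<beta> \<mu> w + k"
  shows "has_variational_derivative F u (energy_gradient \<beta> \<mu> u)"
  unfolding has_variational_derivative_def One_nat_def
proof (intro conjI ballI energy_gradient_fields)
  fix h assume h: "h \<in> fields (Suc 0)"
  have "F (\<lambda>y. u y + \<epsilon> * h y) = integral Icell (\<lambda>y. (u y + \<epsilon> * h y)\<^sup>2 / 2)
      + \<mu>\<^sup>2 * potential \<beta> (\<lambda>y. u y + \<epsilon> * h y) + k" for \<epsilon>
    using F[OF fields_lincomb[OF derivatives_fields(1) h, of 1 \<epsilon>]] by (simp add: energy_def)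
  moreover have "((\<lambda>\<epsilon>. integral Icell (\<lambda>y. (u y + \<epsilon> * h y)\<^sup>2 / 2)
      + \<mu>\<^sup>2 * potential \<beta> (\<lambda>y. u y + \<epsilon> * h y) + k) has_real_derivative
      integral Icell (\<lambda>y. energy_gradient \<beta> \<mu> u y * h y) + 0) (at 0)"
    unfolding integral_energy_gradient[OF h]
    by (intro DERIV_add DERIV_cmult DERIV_const DERIV_kinetic[OF derivatives_fields(1) h] DERIV_potential derivatives_fields h)
  ultimately show "((\<lambda>\<epsilon>. F (\<lambda>y. u y + \<epsilon> * h y)) has_real_derivative
      integral Icell (\<lambda>y. energy_gradient \<beta> \<mu> u y * h y)) (at 0)"
    by simp
qed

end

section \<open>Uniqueness of the gradient\<close>

lemma periodic_eq_zero:
  fixes p :: "real \<Rightarrow> real"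
  assumes per: "\<And>x. p (x + 2) = p x" and z: "\<And>x. x \<in> {-1..1} \<Longrightarrow> p x = 0"
  shows "p x = 0"
proof -
  have add_nat: "p (x + 2 * real n) = p x" for x n
  proof (induction n)
    case (Suc n)
    then show ?case using per[of "x + 2 * real n"] by (simp add: algebra_simps)
  qed simp
  have add_int: "p (x + 2 * real_of_int k) = p x" for k
  proof (cases "k \<ge> 0")
    case True
    then show ?thesis using add_nat[of x "nat k"] by simp
  next
    case False
    then show ?thesis using add_nat[of "x + 2 * real_of_int k" "nat (- k)"] by simp
  qed
  \<comment> \<open>Subtracting this number of periods carries x into the interval from -1 to
    1.\<close>
  have "p (x + 2 * real_of_int (- \<lfloor>(x + 1) / 2\<rfloor>)) = 0"
  proof (rule z)
    have "real_of_int \<lfloor>(x + 1) / 2\<rfloor> \<le> (x + 1) / 2" "(x + 1) / 2 < real_of_int \<lfloor>(x + 1) / 2\<rfloor> + 1"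
      by linarith+
    then show "x + 2 * real_of_int (- \<lfloor>(x + 1) / 2\<rfloor>) \<in> {-1..1}" by (auto simp: field_simps)
  qed
  then show ?thesis unfolding add_int .
qed

text \<open>A continuous nonnegative function with zero integral vanishes on the cell; periodicity
  extends this to the plane, first in y1 and then in y2.\<close>

lemma fields_eq_zero:
  assumes g: "g \<in> fields n" and 0: "integral Icell (\<lambda>y. g y * g y) = 0"
  shows "g y = 0"
proof -
  have I: "Icell = cbox (-1, -1) (1, 1)"
    by (simp add: Icell_def cbox_Pair_eq)
  note c = fieldsD(4)[OF g]
  have z: "g z * g z = 0" if "z \<in> Icell" for z
  proof (rule has_integral_0_cbox_imp_0[of "(-1, -1)" "(1, 1)" "\<lambda>y. g y * g y"])
    show "continuous_on (cbox (-1, -1) (1, 1)) (\<lambda>y. g y * g y)"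
      by (intro continuous_intros continuous_on_subset[OF c]) auto
    show "((\<lambda>y. g y * g y) has_integral 0) (cbox (-1, -1) (1, 1))"
      using has_integral_Icell[of "\<lambda>y. g y * g y"] 0 c by (simp add: I continuous_on_mult)
    show "z \<in> cbox (-1, -1) (1, 1)" using that by (simp add: I)
    show "box (-1, -1) (1, 1) \<noteq> ({} :: (real \<times> real) set)"
      by (auto simp: box_ne_empty Basis_prod_def)
  qed simp
  have z': "g (y1, y2) = 0" if "y1 \<in> {-1..1}" "y2 \<in> {-1..1}" for y1 y2
    using z[of "(y1, y2)"] that by (simp add: Icell_def)
  have 1: "g (y1, y2) = 0" if "y2 \<in> {-1..1}" for y1 y2
    by (rule periodic_eq_zero[of "\<lambda>s. g (s, y2)", OF biperiodicD(1)[OF fieldsD(2)[OF g]] z'[OF _ that]])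
  have "g (y1, y2) = 0" for y1 y2
    by (rule periodic_eq_zero[of "\<lambda>s. g (y1, s)", OF biperiodicD(2)[OF fieldsD(2)[OF g]] 1])
  then show ?thesis by (cases y) simp
qed

text \<open>The difference h of two gradients is itself an admissible variation, and pairing both
  gradients with it shows that the integral of h * h is zero.\<close>

lemma has_variational_derivative_unique:
  assumes f: "has_variational_derivative F u f" and g: "has_variational_derivative F u g"
  shows "f = g"
proof -
  define h where "h = (\<lambda>y. 1 * f y + (- 1) * g y)"
  have fg: "f \<in> fields 1" "g \<in> fields 1"
    using f g by (auto simp: has_variational_derivative_def)
  then have h: "h \<in> fields 1"
    unfolding h_def by (rule fields_lincomb)
  note c = fieldsD(4)[OF fg(1)] fieldsD(4)[OF fg(2)] fieldsD(4)[OF h]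
  have "integral Icell (\<lambda>y. f y * h y) = integral Icell (\<lambda>y. g y * h y)"
    using f g h DERIV_unique by (simp add: has_variational_derivative_def) blast
  moreover have "integral Icell (\<lambda>y. h y * h y) =
      integral Icell (\<lambda>y. f y * h y - g y * h y)"
    by (intro arg_cong[where f = "integral Icell"] ext) (simp add: h_def algebra_simps)
  moreover have "\<dots> = integral Icell (\<lambda>y. f y * h y) - integral Icell (\<lambda>y. g y * h y)"
    by (intro integral_diff integrable_Icell continuous_intros c)
  ultimately have "integral Icell (\<lambda>y. h y * h y) = 0" by simp
  from fields_eq_zero[OF h this] show ?thesis by (auto simp: h_def)
qed

lemma variational_derivative_eq:
  "has_variational_derivative F u g \<Longrightarrow> variational_derivative F u = g"
  unfolding variational_derivative_def
  by (rule the_equality) (auto intro: has_variational_derivative_unique)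

section \<open>The equations of motion\<close>

lemma has_variational_derivative_averaged_hamiltonian:
  assumes u: "u \<in> fields 3" and v: "v \<in> fields 3"
  shows "has_variational_derivative (\<lambda>w. averaged_hamiltonian \<alpha> \<mu> w v) u (energy_gradient (\<alpha> / (2 * sqrt 2)) \<mu> u)"
    and "has_variational_derivative (\<lambda>w. averaged_hamiltonian \<alpha> \<mu> u w) v (energy_gradient (\<alpha> / (2 * sqrt 2)) \<mu> v)"
  by (rule has_variational_derivative_energy[OF u, where k = "energy (\<alpha> / (2 * sqrt 2)) \<mu> v"]
      has_variational_derivative_energy[OF v, where k = "energy (\<alpha> / (2 * sqrt 2)) \<mu> u"],
      simp add: averaged_hamiltonian_energy derivatives_fields(1)[OF u] derivatives_fields(1)[OF v])+

theorem corollary4p3: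
  fixes \<alpha> \<mu> :: real
  assumes "\<alpha> \<noteq> 0" and "\<mu> > 0"
  shows "(\<forall>u \<in> fields 3. \<forall>v \<in> fields 3.
            (\<exists>g. has_variational_derivative (\<lambda>w. averaged_hamiltonian \<alpha> \<mu> w v) u g) \<and>
            (\<exists>g. has_variational_derivative (\<lambda>w. averaged_hamiltonian \<alpha> \<mu> u w) v g))
       \<and> (\<forall>S \<xi> \<eta>. open S \<longrightarrow> (\<forall>\<tau>\<in>S. \<xi> \<tau> \<in> fields 3 \<and> \<eta> \<tau> \<in> fields 3) \<longrightarrow>
            (solves_hamilton (averaged_hamiltonian \<alpha> \<mu>) S \<xi> \<eta> \<longleftrightarrow>
             (\<forall>\<tau>\<in>S. \<forall>y.
                ((\<lambda>t. \<xi> t y) has_real_derivative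
                   (- D1 (\<xi> \<tau>) y
                    - \<mu>\<^sup>2 / 24 * D1 (D1 (D1 (\<xi> \<tau>))) y
                    - \<mu>\<^sup>2 / 2 * D1inv (D2 (D2 (\<xi> \<tau>))) y
                    - \<alpha> * \<mu>\<^sup>2 / (2 * sqrt 2) * D1 (\<lambda>z. (\<xi> \<tau> z)\<^sup>2) y)) (at \<tau>) \<and>
                ((\<lambda>t. \<eta> t y) has_real_derivative
                   (D1 (\<eta> \<tau>) y
                    + \<mu>\<^sup>2 / 2 * D1inv (D2 (D2 (\<eta> \<tau>))) y
                    + \<mu>\<^sup>2 / 24 * D1 (D1 (D1 (\<eta> \<tau>))) y
                    + \<alpha> * \<mu>\<^sup>2 / (2 * sqrt 2) * D1 (\<lambda>z. (\<eta> \<tau> z)\<^sup>2) y)) (at \<tau>))))"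
proof (intro conjI ballI allI impI)
  \<comment> \<open>Existence of both gradients ensures that \<open>variational_derivative\<close>
    denotes a true gradient and not an unspecified value of \<open>THE\<close>.\<close>
  fix u v assume "u \<in> fields 3" "v \<in> fields 3"
  note hvd = has_variational_derivative_averaged_hamiltonian[OF this]
  show "\<exists>g. has_variational_derivative (\<lambda>w. averaged_hamiltonian \<alpha> \<mu> w v) u g"
    "\<exists>g. has_variational_derivative (\<lambda>w. averaged_hamiltonian \<alpha> \<mu> u w) v g"
    by (rule exI, rule hvd)+
next
  fix S :: "real set" and \<xi> \<eta> :: "real \<Rightarrow> field"
  assume fields: "\<forall>\<tau>\<in>S. \<xi> \<tau> \<in> fields 3 \<and> \<eta> \<tau> \<in> fields 3"
  have xi: "- D1 (variational_derivative (\<lambda>u. averaged_hamiltonian \<alpha> \<mu> u (\<eta> \<tau>)) (\<xi> \<tau>)) y =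
      - D1 (\<xi> \<tau>) y - \<mu>\<^sup>2 / 24 * D1 (D1 (D1 (\<xi> \<tau>))) y - \<mu>\<^sup>2 / 2 * D1inv (D2 (D2 (\<xi> \<tau>))) y
      - \<alpha> * \<mu>\<^sup>2 / (2 * sqrt 2) * D1 (\<lambda>z. (\<xi> \<tau> z)\<^sup>2) y"
    and eta: "D1 (variational_derivative (\<lambda>v. averaged_hamiltonian \<alpha> \<mu> (\<xi> \<tau>) v) (\<eta> \<tau>)) y =
      D1 (\<eta> \<tau>) y + \<mu>\<^sup>2 / 2 * D1inv (D2 (D2 (\<eta> \<tau>))) y + \<mu>\<^sup>2 / 24 * D1 (D1 (D1 (\<eta> \<tau>))) y
      + \<alpha> * \<mu>\<^sup>2 / (2 * sqrt 2) * D1 (\<lambda>z. (\<eta> \<tau> z)\<^sup>2) y"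
    if "\<tau> \<in> S" for \<tau> y
  proof -
    have f: "\<xi> \<tau> \<in> fields 3" "\<eta> \<tau> \<in> fields 3"
      using fields that by auto
    note hvd = has_variational_derivative_averaged_hamiltonian[OF f, THEN variational_derivative_eq]
    show "- D1 (variational_derivative (\<lambda>u. averaged_hamiltonian \<alpha> \<mu> u (\<eta> \<tau>)) (\<xi> \<tau>)) y =
      - D1 (\<xi> \<tau>) y - \<mu>\<^sup>2 / 24 * D1 (D1 (D1 (\<xi> \<tau>))) y - \<mu>\<^sup>2 / 2 * D1inv (D2 (D2 (\<xi> \<tau>))) y
      - \<alpha> * \<mu>\<^sup>2 / (2 * sqrt 2) * D1 (\<lambda>z. (\<xi> \<tau> z)\<^sup>2) y"
      unfolding hvd D1_energy_gradient[OF f(1)] by simp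
    show "D1 (variational_derivative (\<lambda>v. averaged_hamiltonian \<alpha> \<mu> (\<xi> \<tau>) v) (\<eta> \<tau>)) y =
      D1 (\<eta> \<tau>) y + \<mu>\<^sup>2 / 2 * D1inv (D2 (D2 (\<eta> \<tau>))) y + \<mu>\<^sup>2 / 24 * D1 (D1 (D1 (\<eta> \<tau>))) y
      + \<alpha> * \<mu>\<^sup>2 / (2 * sqrt 2) * D1 (\<lambda>z. (\<eta> \<tau> z)\<^sup>2) y"
      unfolding hvd D1_energy_gradient[OF f(2)] by simp
  qed
  show "solves_hamilton (averaged_hamiltonian \<alpha> \<mu>) S \<xi> \<eta> \<longleftrightarrow>
             (\<forall>\<tau>\<in>S. \<forall>y.
                ((\<lambda>t. \<xi> t y) has_real_derivative
                   (- D1 (\<xi> \<tau>) y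
                    - \<mu>\<^sup>2 / 24 * D1 (D1 (D1 (\<xi> \<tau>))) y
                    - \<mu>\<^sup>2 / 2 * D1inv (D2 (D2 (\<xi> \<tau>))) y
                    - \<alpha> * \<mu>\<^sup>2 / (2 * sqrt 2) * D1 (\<lambda>z. (\<xi> \<tau> z)\<^sup>2) y)) (at \<tau>) \<and>
                ((\<lambda>t. \<eta> t y) has_real_derivative
                   (D1 (\<eta> \<tau>) y
                    + \<mu>\<^sup>2 / 2 * D1inv (D2 (D2 (\<eta> \<tau>))) y
                    + \<mu>\<^sup>2 / 24 * D1 (D1 (D1 (\<eta> \<tau>))) y
                    + \<alpha> * \<mu>\<^sup>2 / (2 * sqrt 2) * D1 (\<lambda>z. (\<eta> \<tau> z)\<^sup>2) y)) (at \<tau>))"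
    \<comment> \<open>At each time in S the two right-hand sides are equal numbers, so both systems
      state the same derivatives.\<close>
    unfolding solves_hamilton_def by (intro ball_cong refl) (simp only: xi eta)
qed

end
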